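(* Let $\gamma\in(\tfrac12,1)$ be fixed, and let $\rho\in(0,1]$, $C\ge 0$, $\hat C\ge 0$. Define $$M:=\frac{\gamma(1+5\gamma)}{3(2\gamma-1)}+\frac{1+6\gamma}{3(2\gamma-1)}\cdot\frac{C+\hat C}{\rho},\qquad \delta:=\frac{2\gamma-1}{8\sqrt M}.$$ Let $G=\frac1n\sum_{i=1}^n G_i$ with $G_i:\mathbb{R}^p\to\mathbb{R}^p$, and suppose that: (i) $\{x: Gx=0\}\neq\emptyset$; (ii) there is $L>0$ such that $\frac1n\sum_{i=1}^n\|G_ix-G_iy\|^2\le L^2\|x-y\|^2$ for all $x,y\in\mathbb{R}^p$; (iii) there exist $x^\star$ with $Gx^\star=0$ and $\kappa\ge 0$ such that $\langle Gx,x-x^\star\rangle\ge-\kappa\|Gx\|^2$ for all $x\in\mathbb{R}^p$, and $L\kappa\le\delta$. Let $\{x^k\}_{k\ge0}$ be generated from $x^0\in\mathbb{R}^p$ by the scheme (VFR) $x^{k+1}:=x^k-\eta\widetilde S_\gamma^k$ for $k\ge0$, where $\widetilde S^0_\gamma=(1-\gamma)Gx^0$ and $\widetilde S^k_\gamma$ is a stochastic unbiased variance-reduced estimator (see context) of $S^k_\gamma:=Gx^k-\gamma Gx^{k-1}$ with constants $\rho,C,\hat C$, and where the learning rate $\eta>0$ satisfies $$\frac{8\kappa}{2\gamma-1}\le\eta\le\frac{1}{L\sqrt M}.$$ Then, for every $K\ge 0$, $$\frac1{K+1}\sum_{k=0}^K\mathbb{E}\big[\|Gx^k\|^2\big]\le\frac{\Theta_1\|x^0-x^\star\|^2}{K+1},\qquad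 \frac1{K+1}\sum_{k=1}^K\mathbb{E}\big[\|x^k-x^{k-1}\|^2\big]\le\frac{\Theta_2\|x^0-x^\star\|^2}{K+1},$$ where $$\Theta_1:=\frac{2(1+L^2\eta^2)}{\gamma(1-\gamma)\eta^2},\qquad \Theta_2:=\frac{8(1+L^2\eta^2)}{3(2\gamma-1)(1-ML^2\eta^2)},$$ with $\Theta_2$ understood as $+\infty$ (second bound vacuous) if $\eta=\frac1{L\sqrt M}$.
   Context: Norms and inner products are Euclidean on $\mathbb{R}^p$; $x^0$ is deterministic and by convention $x^{-1}=x^{-2}:=x^0$. $\mathcal{F}_k:=\sigma(x^0,\dots,x^k)$, $\mathbb{E}_k[\cdot]:=\mathbb{E}[\cdot\mid\mathcal{F}_k]$ and $\mathbb{E}[\cdot]$ is the total expectation. Definition (stochastic unbiased variance-reduced estimator). $\widetilde S^k_\gamma$ is such an estimator of $S^k_\gamma:=Gx^k-\gamma Gx^{k-1}$ with constants $\rho\in(0,1]$, $C\ge0$, $\hat C\ge0$ if there is a nonnegative sequence $\{\Delta_k\}$, with $\Delta_{-1}=0$, such that for all $k\ge0$: $\mathbb{E}_k[\widetilde S^k_\gamma-S^k_\gamma]=0$; $\ \mathbb{E}[\|\widetilde S^k_\gamma-S^k_\gamma\|^2]\le\Delta_k$; and $\ \Delta_k\le(1-\rho)\Delta_{k-1}+C\,U_k+\hat C\,U_{k-1}$, where $U_k:=\frac1n\sum_{i=1}^n\mathbb{E}[\|G_ix^k-G_ix^{k-1}\|^2]$ (so $U_0=U_{-1}=0$). *)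

theory Defs
  imports "HOL-Probability.Probability"
begin

text \<open>
  Expectations of squared norms are taken as \<open>[0,\<infinity>]\<close>-valued integrals, so that
  they are meaningful without an integrability assumption, and an upper bound by a real
  number includes finiteness.
\<close>

definition mean_sq :: "'a measure \<Rightarrow> ('a \<Rightarrow> 'b::real_normed_vector) \<Rightarrow> ennreal" where
  "mean_sq P X = (\<integral>\<^sup>+ \<omega>. ennreal ((norm (X \<omega>))\<^sup>2) \<partial>P)"

definition avg_op :: "nat \<Rightarrow> (nat \<Rightarrow> real^'p \<Rightarrow> real^'p) \<Rightarrow> real^'p \<Rightarrow> real^'p" where
  "avg_op n G y = (1 / real n) *\<^sub>R (\<Sum>i=1..n. G i y)"

definition history :: "'a measure \<Rightarrow> (nat \<Rightarrow> 'a \<Rightarrow> 'b::topological_space) \<Rightarrow> nat \<Rightarrow> 'a measure" where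
  "history P x k = sigma (space P) (\<Union>i\<in>{..k}. sets (vimage_algebra (space P) (x i) borel))"

text \<open>The library's conditional expectation is real-valued; vectors are treated componentwise.\<close>

definition vec_cond_exp :: "'a measure \<Rightarrow> 'a measure \<Rightarrow> ('a \<Rightarrow> real^'p) \<Rightarrow> 'a \<Rightarrow> real^'p" where
  "vec_cond_exp P F X \<omega> = (\<chi> j. real_cond_exp P F (\<lambda>\<omega>'. X \<omega>' $ j) \<omega>)"

text \<open>
  Truncated subtraction gives \<open>x (0 - 1) = x 0\<close>, which is exactly the convention
  \<open>x\<^sup>-\<^sup>1 = x\<^sup>-\<^sup>2 = x\<^sup>0\<close>. In particular \<open>mean_sq_incr\<close> vanishes at \<open>k = 0\<close>, and in
  \<open>vr_estimator\<close> the term with index \<open>k - 1\<close> is also correct (zero) for \<open>k = 0\<close>.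
\<close>

definition fr_direction ::
    "real \<Rightarrow> (real^'p \<Rightarrow> real^'p) \<Rightarrow> (nat \<Rightarrow> 'a \<Rightarrow> real^'p) \<Rightarrow> nat \<Rightarrow> 'a \<Rightarrow> real^'p" where
  "fr_direction \<gamma> H x k \<omega> = H (x k \<omega>) - \<gamma> *\<^sub>R H (x (k - 1) \<omega>)"

definition mean_sq_incr ::
    "'a measure \<Rightarrow> nat \<Rightarrow> (nat \<Rightarrow> real^'p \<Rightarrow> real^'p) \<Rightarrow> (nat \<Rightarrow> 'a \<Rightarrow> real^'p) \<Rightarrow> nat \<Rightarrow> ennreal" where
  "mean_sq_incr P n G x k =
     ennreal (1 / real n) * (\<Sum>i=1..n. mean_sq P (\<lambda>\<omega>. G i (x k \<omega>) - G i (x (k - 1) \<omega>)))"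

text \<open>\<open>\<Delta>\<close> is indexed from \<open>0\<close>; the value \<open>\<Delta>\<^sub>-\<^sub>1 = 0\<close> is the case distinction in the recursion.\<close>

definition vr_estimator ::
    "'a measure \<Rightarrow> nat \<Rightarrow> (nat \<Rightarrow> real^'p \<Rightarrow> real^'p) \<Rightarrow> real \<Rightarrow> (nat \<Rightarrow> 'a \<Rightarrow> real^'p) \<Rightarrow>
     (nat \<Rightarrow> 'a \<Rightarrow> real^'p) \<Rightarrow> real \<Rightarrow> real \<Rightarrow> real \<Rightarrow> bool" where
  "vr_estimator P n G \<gamma> x S \<rho> C C' \<longleftrightarrow>
     0 < \<rho> \<and> \<rho> \<le> 1 \<and> 0 \<le> C \<and> 0 \<le> C' \<and>
     (\<forall>k. x k \<in> borel_measurable P \<and> S k \<in> borel_measurable P) \<and>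
     (\<exists>\<Delta> :: nat \<Rightarrow> real. (\<forall>k. 0 \<le> \<Delta> k) \<and>
        (\<forall>k.
          (AE \<omega> in P. vec_cond_exp P (history P x k)
              (\<lambda>\<omega>'. S k \<omega>' - fr_direction \<gamma> (avg_op n G) x k \<omega>') \<omega> = 0) \<and>
          mean_sq P (\<lambda>\<omega>. S k \<omega> - fr_direction \<gamma> (avg_op n G) x k \<omega>) \<le> ennreal (\<Delta> k) \<and>
          ennreal (\<Delta> k) \<le> ennreal ((1 - \<rho>) * (if k = 0 then 0 else \<Delta> (k - 1)))
              + ennreal C * mean_sq_incr P n G x k + ennreal C' * mean_sq_incr P n G x (k - 1)))"

end

theory Submission
  imports Defs
begin

text \<open>
  Write \<open>H\<close> for the average of the \<open>G i\<close>, \<open>e\<^sub>k\<close> for the estimation error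
  \<open>S k - (H x\<^sub>k - \<gamma> H x\<^sub>k\<^sub>-\<^sub>1)\<close>, and shift the iterate to \<open>y\<^sub>k = x\<^sub>k + \<gamma>\<eta> H x\<^sub>k\<^sub>-\<^sub>1\<close>. The
  reflection term then disappears from the recursion:
  \<open>y\<^sub>k\<^sub>+\<^sub>1 = y\<^sub>k - (1-\<gamma>)\<eta> H x\<^sub>k - \<eta> e\<^sub>k\<close>. Expanding \<open>\<parallel>y\<^sub>k\<^sub>+\<^sub>1 - x\<^sup>\<star>\<parallel>\<^sup>2\<close> produces
  \<open>\<langle>H x\<^sub>k, H x\<^sub>k\<^sub>-\<^sub>1\<rangle>\<close>, which polarization turns into good negative multiples of
  \<open>\<parallel>H x\<^sub>k\<parallel>\<^sup>2\<close> and \<open>\<parallel>H x\<^sub>k\<^sub>-\<^sub>1\<parallel>\<^sup>2\<close> and a bad multiple of \<open>\<parallel>H x\<^sub>k - H x\<^sub>k\<^sub>-\<^sub>1\<parallel>\<^sup>2\<close>.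
  The defect \<open>\<kappa>\<close> in the weak Minty condition costs at most a quarter of the negative
  \<open>\<parallel>H x\<^sub>k\<parallel>\<^sup>2\<close>, because \<open>\<eta> \<ge> 8\<kappa>/(2\<gamma>-1)\<close>. The other three quarters are spent on adding
  \<open>c \<parallel>x\<^sub>k\<^sub>+\<^sub>1 - x\<^sub>k\<parallel>\<^sup>2\<close> to the left-hand side: \<open>c = 3(2\<gamma>-1)/4\<close> is the largest weight for which
  they suffice (\<open>reflected_step_bound\<close>).

  The error enters linearly only through an inner product with a vector that is determined by
  \<open>x\<^sub>k\<close> and \<open>x\<^sub>k\<^sub>-\<^sub>1\<close>; unbiasedness makes the expectation of that product zero
  (\<open>integral_inner_eq_0_if_cond_exp_eq_0\<close>), so that only total expectations remain
  (\<open>reflected_step_expectation_bound\<close>).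

  Summing over \<open>k\<close> telescopes the distances (\<open>telescoped_lyapunov_bound\<close>). The remaining bad
  terms are \<open>E\<parallel>H x\<^sub>k - H x\<^sub>k\<^sub>-\<^sub>1\<parallel>\<^sup>2\<close>, at most \<open>U\<^sub>k\<close> by convexity of the squared norm, and
  \<open>E\<parallel>e\<^sub>k\<parallel>\<^sup>2\<close>, whose sum is at most \<open>(C + C')/\<rho>\<close> times that of \<open>U\<^sub>k\<close> because the variance
  recursion contracts (\<open>sum_le_if_contracting\<close>). Since \<open>U\<^sub>k \<le> L\<^sup>2 E\<parallel>x\<^sub>k - x\<^sub>k\<^sub>-\<^sub>1\<parallel>\<^sup>2\<close>,
  together they are at most \<open>c M L\<^sup>2\<eta>\<^sup>2\<close> times the sum of the squared increments, and the upper
  bound on \<open>\<eta>\<close> says exactly that \<open>M L\<^sup>2\<eta>\<^sup>2 \<le> 1\<close>. What is left over on the left-hand side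
  gives both estimates, with \<open>\<parallel>y\<^sub>0 - x\<^sup>\<star>\<parallel>\<^sup>2 \<le> 2(1 + L\<^sup>2\<eta>\<^sup>2) \<parallel>x\<^sub>0 - x\<^sup>\<star>\<parallel>\<^sup>2\<close> on the right.
\<close>

section \<open>Averages of operators\<close>

lemma norm_average_sq_le:
  fixes v :: "'i \<Rightarrow> 'b::real_normed_vector"
  assumes "finite I" "I \<noteq> {}"
  shows "(norm ((1 / real (card I)) *\<^sub>R (\<Sum>i\<in>I. v i)))\<^sup>2
           \<le> (1 / real (card I)) * (\<Sum>i\<in>I. (norm (v i))\<^sup>2)"
proof -
  have n: "real (card I) > 0" using assms by (simp add: card_gt_0_iff)
  have "(norm (\<Sum>i\<in>I. v i))\<^sup>2 \<le> (\<Sum>i\<in>I. norm (v i))\<^sup>2"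
    by (intro power_mono norm_sum) simp
  also have "\<dots> \<le> real (card I) * (\<Sum>i\<in>I. (norm (v i))\<^sup>2)"
    using sum_squared_le_sum_of_squares[of "\<lambda>i. norm (v i)" I] by (simp add: mult.commute)
  finally show ?thesis
    using n by (simp add: power_divide divide_simps power2_eq_square mult_ac)
qed

lemma avg_op_diff_sq_le:
  assumes "1 \<le> n"
  shows "(norm (avg_op n G y - avg_op n G z))\<^sup>2
           \<le> (1 / real n) * (\<Sum>i=1..n. (norm (G i y - G i z))\<^sup>2)"
  using norm_average_sq_le[of "{1..n}" "\<lambda>i. G i y - G i z"] assms
  by (simp add: avg_op_def sum_subtractf scaleR_diff_right[symmetric])

section \<open>Square-integrable random vectors\<close>

lemma norm_add_sq_le:
  fixes a b :: "'b::real_inner"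
  shows "(norm (a + b))\<^sup>2 \<le> 2 * (norm a)\<^sup>2 + 2 * (norm b)\<^sup>2"
  using zero_le_power2[of "norm (a - b)"]
  by (simp add: power2_norm_eq_inner inner_simps inner_commute)

text \<open>
  All second moments in the argument turn out to be finite, and on this class the
  \<open>[0,\<infinity>]\<close>-valued \<open>mean_sq\<close> can be replaced by a real integral, which is linear.
\<close>

definition sq_integrable :: "'a measure \<Rightarrow> ('a \<Rightarrow> 'b::euclidean_space) \<Rightarrow> bool" where
  "sq_integrable M f \<longleftrightarrow> f \<in> borel_measurable M \<and> integrable M (\<lambda>\<omega>. (norm (f \<omega>))\<^sup>2)"

lemma sq_integrable_add:
  assumes "sq_integrable M f" "sq_integrable M g"
  shows "sq_integrable M (\<lambda>\<omega>. f \<omega> + g \<omega>)"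
proof -
  have [measurable]: "f \<in> borel_measurable M" "g \<in> borel_measurable M"
    using assms by (auto simp: sq_integrable_def)
  have "integrable M (\<lambda>\<omega>. (norm (f \<omega> + g \<omega>))\<^sup>2)"
  proof (rule Bochner_Integration.integrable_bound)
    show "integrable M (\<lambda>\<omega>. 2 * (norm (f \<omega>))\<^sup>2 + 2 * (norm (g \<omega>))\<^sup>2)"
      using assms by (auto simp: sq_integrable_def)
    show "AE \<omega> in M. norm ((norm (f \<omega> + g \<omega>))\<^sup>2)
        \<le> norm (2 * (norm (f \<omega>))\<^sup>2 + 2 * (norm (g \<omega>))\<^sup>2)"
      using norm_add_sq_le by auto
  qed simp
  then show ?thesis by (simp add: sq_integrable_def)
qed

lemma sq_integrable_scaleR:
  "sq_integrable M f \<Longrightarrow> sq_integrable M (\<lambda>\<omega>. r *\<^sub>R f \<omega>)"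
  by (auto simp: sq_integrable_def power_mult_distrib)

lemma sq_integrable_diff:
  assumes "sq_integrable M f" "sq_integrable M g"
  shows "sq_integrable M (\<lambda>\<omega>. f \<omega> - g \<omega>)"
  using sq_integrable_add[OF assms(1) sq_integrable_scaleR[OF assms(2), of "-1"]] by simp

lemma (in finite_measure) sq_integrable_const: "sq_integrable M (\<lambda>\<omega>. v)"
  by (simp add: sq_integrable_def)

lemma sq_integrable_cong:
  assumes "\<And>\<omega>. \<omega> \<in> space M \<Longrightarrow> f \<omega> = g \<omega>"
  shows "sq_integrable M f \<longleftrightarrow> sq_integrable M g"
  unfolding sq_integrable_def
  using assms by (intro conj_cong measurable_cong Bochner_Integration.integrable_cong) auto

lemma borel_measurable_if_sq_lipschitz:
  fixes h :: "'b::real_normed_vector \<Rightarrow> 'c::real_normed_vector"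
  assumes "\<And>y z. (norm (h y - h z))\<^sup>2 \<le> B\<^sup>2 * (norm (y - z))\<^sup>2"
  shows "h \<in> borel_measurable borel"
proof -
  have "norm (h y - h z) \<le> \<bar>B\<bar> * norm (y - z)" for y z
    by (rule power2_le_imp_le) (simp_all add: power_mult_distrib assms)
  then have "\<bar>B\<bar>-lipschitz_on UNIV h"
    by (intro lipschitz_onI) (auto simp: dist_norm)
  then show ?thesis
    by (intro borel_measurable_continuous_onI lipschitz_on_continuous_on)
qed

text \<open>
  The Lipschitz bound controls \<open>h (f \<omega>) - h 0\<close> by \<open>f \<omega>\<close>; the constant \<open>h 0\<close> is
  square-integrable because the measure is finite.
\<close>

lemma (in finite_measure) sq_integrable_lipschitz:
  assumes f: "sq_integrable M f"
    and lip: "\<And>y z. (norm (h y - h z))\<^sup>2 \<le> B\<^sup>2 * (norm (y - z))\<^sup>2"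
  shows "sq_integrable M (\<lambda>\<omega>. h (f \<omega>))"
proof -
  have [measurable]: "h \<in> borel_measurable borel"
    using lip by (rule borel_measurable_if_sq_lipschitz)
  have [measurable]: "f \<in> borel_measurable M"
    using f by (auto simp: sq_integrable_def)
  have "sq_integrable M (\<lambda>\<omega>. h (f \<omega>) - h 0)"
    unfolding sq_integrable_def
  proof
    show "integrable M (\<lambda>\<omega>. (norm (h (f \<omega>) - h 0))\<^sup>2)"
    proof (rule Bochner_Integration.integrable_bound)
      show "integrable M (\<lambda>\<omega>. B\<^sup>2 * (norm (f \<omega>))\<^sup>2)"
        using f by (auto simp: sq_integrable_def)
      show "AE \<omega> in M. norm ((norm (h (f \<omega>) - h 0))\<^sup>2) \<le> norm (B\<^sup>2 * (norm (f \<omega>))\<^sup>2)"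
        using lip[of _ 0] by (auto simp: abs_of_nonneg)
    qed simp
  qed simp
  from sq_integrable_add[OF this sq_integrable_const[of "h 0"]] show ?thesis by simp
qed

text \<open>Polarization reduces the inner product to three squared norms.\<close>

lemma integrable_inner_sq_integrable:
  assumes "sq_integrable M f" "sq_integrable M g"
  shows "integrable M (\<lambda>\<omega>. f \<omega> \<bullet> g \<omega>)"
proof -
  have "f \<omega> \<bullet> g \<omega> = ((norm (f \<omega> + g \<omega>))\<^sup>2 - (norm (f \<omega>))\<^sup>2 - (norm (g \<omega>))\<^sup>2) / 2" for \<omega>
    by (simp add: power2_norm_eq_inner inner_simps inner_commute)
  then have eq: "(\<lambda>\<omega>. f \<omega> \<bullet> g \<omega>) =
      (\<lambda>\<omega>. ((norm (f \<omega> + g \<omega>))\<^sup>2 - (norm (f \<omega>))\<^sup>2 - (norm (g \<omega>))\<^sup>2) / 2)"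
    by (rule ext)
  show ?thesis
    unfolding eq using assms sq_integrable_add[OF assms] by (simp add: sq_integrable_def)
qed

lemma sq_integrable_component:
  fixes f :: "'a \<Rightarrow> real^'p"
  assumes "sq_integrable M f"
  shows "sq_integrable M (\<lambda>\<omega>. f \<omega> $ j)"
proof -
  have [measurable]: "f \<in> borel_measurable M"
    using assms by (auto simp: sq_integrable_def)
  have [measurable]: "(\<lambda>v::real^'p. v $ j) \<in> borel_measurable borel"
    by (intro borel_measurable_continuous_onI continuous_intros)
  show ?thesis
    unfolding sq_integrable_def
  proof
    show "integrable M (\<lambda>\<omega>. (norm (f \<omega> $ j))\<^sup>2)"
    proof (rule Bochner_Integration.integrable_bound)
      show "integrable M (\<lambda>\<omega>. (norm (f \<omega>))\<^sup>2)"
        using assms by (auto simp: sq_integrable_def)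
      show "AE \<omega> in M. norm ((norm (f \<omega> $ j))\<^sup>2) \<le> norm ((norm (f \<omega>))\<^sup>2)"
        using component_le_norm_cart[of "f _" j] by (intro AE_I2) (simp add: power2_le_iff_abs_le)
    qed simp
  qed simp
qed

lemma mean_sq_eq_integral:
  "sq_integrable M f \<Longrightarrow> mean_sq M f = ennreal (\<integral>\<omega>. (norm (f \<omega>))\<^sup>2 \<partial>M)"
  unfolding mean_sq_def sq_integrable_def by (intro nn_integral_eq_integral) auto

lemma sq_integrable_if_mean_sq_bounded:
  assumes "f \<in> borel_measurable M" "mean_sq M f \<le> ennreal B"
  shows "sq_integrable M f"
proof -
  have "mean_sq M f < \<infinity>"
    using assms(2) by (rule le_less_trans) simp
  then show ?thesis
    using assms(1) unfolding sq_integrable_def mean_sq_def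
    by (auto intro!: integrableI_bounded)
qed

section \<open>Orthogonality of unbiased errors to the past\<close>

lemma space_history [simp]: "space (history P x k) = space P"
  unfolding history_def by (rule space_measure_of_conv)

lemma sets_history:
  "sets (history P x k) =
     sigma_sets (space P) (\<Union>i\<in>{..k}. sets (vimage_algebra (space P) (x i) borel))"
  unfolding history_def
  using sets.sets_into_space by (intro sets_measure_of) fastforce

lemma subalgebra_history:
  assumes "\<And>i. i \<le> k \<Longrightarrow> x i \<in> borel_measurable P"
  shows "subalgebra P (history P x k)"
proof -
  have "(\<Union>i\<in>{..k}. sets (vimage_algebra (space P) (x i) borel)) \<subseteq> sets P"
    using assms by (auto simp: sets_vimage_algebra2 measurable_space)
  then show ?thesis
    unfolding subalgebra_def sets_history by (simp add: sets.sigma_sets_subset)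
qed

lemma measurable_history:
  assumes "i \<le> k"
  shows "x i \<in> borel_measurable (history P x k)"
proof (rule measurableI)
  fix A :: "'b set" assume "A \<in> sets borel"
  then have "x i -` A \<inter> space P \<in> sets (vimage_algebra (space P) (x i) borel)"
    by (rule in_vimage_algebra)
  then show "x i -` A \<inter> space (history P x k) \<in> sets (history P x k)"
    using assms by (auto simp: sets_history intro!: sigma_sets.Basic)
qed simp

text \<open>
  In each coordinate the factor known to \<open>F\<close> can be pulled into the conditional expectation;
  square integrability makes the coordinate products integrable, as this requires.
\<close>

lemma (in prob_space) integral_inner_eq_0_if_cond_exp_eq_0:
  fixes e w :: "'a \<Rightarrow> real^'p"
  assumes sub: "subalgebra M F"
    and e: "sq_integrable M e" and w: "sq_integrable M w"
    and wF: "w \<in> borel_measurable F"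
    and ce: "AE \<omega> in M. vec_cond_exp M F e \<omega> = 0"
  shows "(\<integral>\<omega>. e \<omega> \<bullet> w \<omega> \<partial>M) = 0"
proof -
  interpret finite_measure_subalgebra M F
    by unfold_locales (rule sub)
  have comp: "integrable M (\<lambda>\<omega>. w \<omega> $ j * e \<omega> $ j)" for j
    using integrable_inner_sq_integrable[OF sq_integrable_component[OF w] sq_integrable_component[OF e]]
    by simp
  have "(\<integral>\<omega>. w \<omega> $ j * e \<omega> $ j \<partial>M) = 0" for j
  proof -
    have [measurable]: "(\<lambda>v::real^'p. v $ j) \<in> borel_measurable borel"
      by (intro borel_measurable_continuous_onI continuous_intros)
    have wj: "(\<lambda>\<omega>. w \<omega> $ j) \<in> borel_measurable F"
      using wF by measurable
    have ej: "(\<lambda>\<omega>. e \<omega> $ j) \<in> borel_measurable M"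
      using sq_integrable_component[OF e, of j] by (simp add: sq_integrable_def)
    have "AE \<omega> in M. real_cond_exp M F (\<lambda>\<omega>. e \<omega> $ j) \<omega> = 0"
      using ce by eventually_elim (simp add: vec_cond_exp_def vec_eq_iff)
    then have "(\<integral>\<omega>. w \<omega> $ j * real_cond_exp M F (\<lambda>\<omega>. e \<omega> $ j) \<omega> \<partial>M) = 0"
      by (intro integral_eq_zero_AE) auto
    then show ?thesis
      using real_cond_exp_intg(2)[OF comp wj ej] by simp
  qed
  then show ?thesis
    using comp by (simp add: inner_vec_def mult.commute)
qed

section \<open>One step of the reflected scheme\<close>

text \<open>
  Here \<open>p = x\<^sub>k - x\<^sup>\<star>\<close>, \<open>a = H x\<^sub>k\<close>, \<open>b = H x\<^sub>k\<^sub>-\<^sub>1\<close> and \<open>e\<close> is the error, so the left-hand side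
  holds the distance and the increment after the step. Besides polarization of \<open>\<langle>a, b\<rangle>\<close>, the
  bound rests on
  \<open>\<parallel>a - \<gamma>b\<parallel>\<^sup>2 = (1-\<gamma>)\<parallel>a\<parallel>\<^sup>2 - \<gamma>(1-\<gamma>)\<parallel>b\<parallel>\<^sup>2 + \<gamma>\<parallel>a - b\<parallel>\<^sup>2\<close>:
  the increment, too, splits into the three squared norms that the distance produces. The error
  is kept exact, since its inner product term vanishes only in expectation.
\<close>

lemma reflected_step_bound:
  fixes p a b e :: "'b::real_inner"
  assumes \<gamma>: "1/2 < \<gamma>" "\<gamma> < 1" and \<eta>: "0 < \<eta>" "8 * \<kappa> \<le> (2*\<gamma> - 1) * \<eta>"
    and weak: "a \<bullet> p \<ge> - \<kappa> * (norm a)\<^sup>2"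
    and c: "c = 3 * (2*\<gamma> - 1) / 4"
  shows "(norm (p + (\<gamma>*\<eta>) *\<^sub>R b - ((1-\<gamma>)*\<eta>) *\<^sub>R a - \<eta> *\<^sub>R e))\<^sup>2
           + c * (norm (\<eta> *\<^sub>R (a - \<gamma> *\<^sub>R b + e)))\<^sup>2
           + \<gamma>*(1-\<gamma>)*\<eta>\<^sup>2*(1+c) * (norm b)\<^sup>2
         \<le> (norm (p + (\<gamma>*\<eta>) *\<^sub>R b))\<^sup>2 + \<gamma>*(1-\<gamma>+c)*\<eta>\<^sup>2 * (norm (a - b))\<^sup>2
           + (1+c)*\<eta>\<^sup>2 * (norm e)\<^sup>2
           - 2*\<eta> * (e \<bullet> (p + (\<gamma>*\<eta>) *\<^sub>R b - ((1-\<gamma>)*\<eta>) *\<^sub>R a - (c*\<eta>) *\<^sub>R (a - \<gamma> *\<^sub>R b)))"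
    (is "?l \<le> ?r")
proof -
  have "?l - ?r = - (2*(1-\<gamma>)*\<eta>) * (a \<bullet> p) - (1-\<gamma>)*\<eta>\<^sup>2*(2*\<gamma>-1-c) * (a \<bullet> a)"
    unfolding power2_norm_eq_inner
    by (simp add: inner_simps inner_commute) (simp add: algebra_simps power2_eq_square)
  \<comment> \<open>All terms without \<open>p\<close> cancel, except for those in \<open>\<parallel>a\<parallel>\<^sup>2\<close>. With this choice of
    \<open>c\<close>, \<open>2\<gamma> - 1 - c\<close> is \<open>(2\<gamma> - 1)/4\<close>, the part reserved for \<open>\<kappa>\<close>.\<close>
  also have "\<dots> \<le> (2*(1-\<gamma>)*\<eta>) * (\<kappa> * (a \<bullet> a)) - (1-\<gamma>)*\<eta>\<^sup>2*(2*\<gamma>-1-c) * (a \<bullet> a)"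
  proof -
    have "(2*(1-\<gamma>)*\<eta>) * (- (a \<bullet> p)) \<le> (2*(1-\<gamma>)*\<eta>) * (\<kappa> * (a \<bullet> a))"
      using weak \<gamma> \<eta> by (intro mult_left_mono) (auto simp: power2_norm_eq_inner)
    then show ?thesis by simp
  qed
  also have "\<dots> = ((1-\<gamma>)*\<eta>*(a \<bullet> a)/4) * (8*\<kappa> - (2*\<gamma>-1)*\<eta>)"
    by (simp add: c field_simps power2_eq_square)
  also have "\<dots> \<le> 0"
    using \<gamma> \<eta> by (intro mult_nonneg_nonpos) auto
  finally show ?thesis by simp
qed

text \<open>
  Integrating the pointwise bound; \<open>w\<close> collects everything that is paired with the error, and
  it is measurable with respect to the past because it depends on \<open>z\<close> and \<open>z'\<close> only.
\<close>

lemma (in prob_space) reflected_step_expectation_bound: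
  fixes z z' zn e :: "'a \<Rightarrow> real^'p"
  assumes sub: "subalgebra M F"
    and z: "sq_integrable M z" "z \<in> borel_measurable F"
    and z': "sq_integrable M z'" "z' \<in> borel_measurable F"
    and e: "sq_integrable M e" "AE \<omega> in M. vec_cond_exp M F e \<omega> = 0"
    and lip: "\<And>y y'. (norm (H y - H y'))\<^sup>2 \<le> L\<^sup>2 * (norm (y - y'))\<^sup>2"
    and zn: "\<And>\<omega>. \<omega> \<in> space M \<Longrightarrow> zn \<omega> = z \<omega> - \<eta> *\<^sub>R (H (z \<omega>) - \<gamma> *\<^sub>R H (z' \<omega>) + e \<omega>)"
    and \<gamma>: "1/2 < \<gamma>" "\<gamma> < 1" and \<eta>: "0 < \<eta>" "8 * \<kappa> \<le> (2*\<gamma> - 1) * \<eta>"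
    and weak: "\<And>y. H y \<bullet> (y - xs) \<ge> - \<kappa> * (norm (H y))\<^sup>2"
    and c: "c = 3 * (2*\<gamma> - 1) / 4"
  shows "(\<integral>\<omega>. (norm (zn \<omega> + (\<gamma>*\<eta>) *\<^sub>R H (z \<omega>) - xs))\<^sup>2 \<partial>M)
           + c * (\<integral>\<omega>. (norm (zn \<omega> - z \<omega>))\<^sup>2 \<partial>M)
           + \<gamma>*(1-\<gamma>)*\<eta>\<^sup>2*(1+c) * (\<integral>\<omega>. (norm (H (z' \<omega>)))\<^sup>2 \<partial>M)
         \<le> (\<integral>\<omega>. (norm (z \<omega> + (\<gamma>*\<eta>) *\<^sub>R H (z' \<omega>) - xs))\<^sup>2 \<partial>M)
           + \<gamma>*(1-\<gamma>+c)*\<eta>\<^sup>2 * (\<integral>\<omega>. (norm (H (z \<omega>) - H (z' \<omega>)))\<^sup>2 \<partial>M)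
           + (1+c)*\<eta>\<^sup>2 * (\<integral>\<omega>. (norm (e \<omega>))\<^sup>2 \<partial>M)"
    (is "?l \<le> ?r")
proof -
  define w where "w \<omega> = (z \<omega> - xs) + (\<gamma>*\<eta>) *\<^sub>R H (z' \<omega>) - ((1-\<gamma>)*\<eta>) *\<^sub>R H (z \<omega>)
      - (c*\<eta>) *\<^sub>R (H (z \<omega>) - \<gamma> *\<^sub>R H (z' \<omega>))" for \<omega>
  have [measurable]: "H \<in> borel_measurable borel"
    using lip by (rule borel_measurable_if_sq_lipschitz)
  note [measurable] = z(2) z'(2)
  have wF: "w \<in> borel_measurable F"
    unfolding w_def by measurable
  note Hz = sq_integrable_lipschitz[OF z(1) lip] and Hz' = sq_integrable_lipschitz[OF z'(1) lip]
  note closure = sq_integrable_add sq_integrable_diff sq_integrable_scaleR sq_integrable_const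
    z(1) z'(1) e(1) Hz Hz'
  have w: "sq_integrable M w"
    unfolding w_def by (intro closure)
  have zn_sq: "sq_integrable M zn"
    by (subst sq_integrable_cong[OF zn]) (auto intro!: closure)
  have int: "integrable M (\<lambda>\<omega>. (norm (f \<omega>))\<^sup>2)" if "sq_integrable M f" for f :: "'a \<Rightarrow> real^'p"
    using that by (simp add: sq_integrable_def)
  have ints: "integrable M (\<lambda>\<omega>. (norm (zn \<omega> + (\<gamma>*\<eta>) *\<^sub>R H (z \<omega>) - xs))\<^sup>2)"
    "integrable M (\<lambda>\<omega>. (norm (zn \<omega> - z \<omega>))\<^sup>2)"
    "integrable M (\<lambda>\<omega>. (norm (H (z' \<omega>)))\<^sup>2)"
    "integrable M (\<lambda>\<omega>. (norm (z \<omega> + (\<gamma>*\<eta>) *\<^sub>R H (z' \<omega>) - xs))\<^sup>2)"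
    "integrable M (\<lambda>\<omega>. (norm (H (z \<omega>) - H (z' \<omega>)))\<^sup>2)"
    "integrable M (\<lambda>\<omega>. (norm (e \<omega>))\<^sup>2)"
    "integrable M (\<lambda>\<omega>. e \<omega> \<bullet> w \<omega>)"
    by (intro int closure zn_sq integrable_inner_sq_integrable w)+
  have "?l = (\<integral>\<omega>. (norm (zn \<omega> + (\<gamma>*\<eta>) *\<^sub>R H (z \<omega>) - xs))\<^sup>2
      + c * (norm (zn \<omega> - z \<omega>))\<^sup>2 + \<gamma>*(1-\<gamma>)*\<eta>\<^sup>2*(1+c) * (norm (H (z' \<omega>)))\<^sup>2 \<partial>M)"
    using ints by simp
  also have "\<dots> \<le> (\<integral>\<omega>. (norm (z \<omega> + (\<gamma>*\<eta>) *\<^sub>R H (z' \<omega>) - xs))\<^sup>2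
      + \<gamma>*(1-\<gamma>+c)*\<eta>\<^sup>2 * (norm (H (z \<omega>) - H (z' \<omega>)))\<^sup>2
      + (1+c)*\<eta>\<^sup>2 * (norm (e \<omega>))\<^sup>2 - 2*\<eta> * (e \<omega> \<bullet> w \<omega>) \<partial>M)"
  proof (intro integral_mono)
    fix \<omega> assume \<omega>: "\<omega> \<in> space M"
    have step: "zn \<omega> - z \<omega> = - (\<eta> *\<^sub>R (H (z \<omega>) - \<gamma> *\<^sub>R H (z' \<omega>) + e \<omega>))"
      "zn \<omega> + (\<gamma>*\<eta>) *\<^sub>R H (z \<omega>) - xs
        = (z \<omega> - xs) + (\<gamma>*\<eta>) *\<^sub>R H (z' \<omega>) - ((1-\<gamma>)*\<eta>) *\<^sub>R H (z \<omega>) - \<eta> *\<^sub>R e \<omega>"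
      "z \<omega> + (\<gamma>*\<eta>) *\<^sub>R H (z' \<omega>) - xs = (z \<omega> - xs) + (\<gamma>*\<eta>) *\<^sub>R H (z' \<omega>)"
      by (simp_all add: zn[OF \<omega>] algebra_simps)
    show "(norm (zn \<omega> + (\<gamma>*\<eta>) *\<^sub>R H (z \<omega>) - xs))\<^sup>2
      + c * (norm (zn \<omega> - z \<omega>))\<^sup>2 + \<gamma>*(1-\<gamma>)*\<eta>\<^sup>2*(1+c) * (norm (H (z' \<omega>)))\<^sup>2
      \<le> (norm (z \<omega> + (\<gamma>*\<eta>) *\<^sub>R H (z' \<omega>) - xs))\<^sup>2
      + \<gamma>*(1-\<gamma>+c)*\<eta>\<^sup>2 * (norm (H (z \<omega>) - H (z' \<omega>)))\<^sup>2
      + (1+c)*\<eta>\<^sup>2 * (norm (e \<omega>))\<^sup>2 - 2*\<eta> * (e \<omega> \<bullet> w \<omega>)"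
      unfolding step norm_minus_cancel w_def
      by (rule reflected_step_bound[OF \<gamma> \<eta> weak c])
  qed (use ints in \<open>auto intro!: Bochner_Integration.integrable_add Bochner_Integration.integrable_diff\<close>)
  also have "\<dots> = ?r - 2*\<eta> * (\<integral>\<omega>. e \<omega> \<bullet> w \<omega> \<partial>M)"
    using ints by simp
  also have "(\<integral>\<omega>. e \<omega> \<bullet> w \<omega> \<partial>M) = 0"
    by (rule integral_inner_eq_0_if_cond_exp_eq_0[OF sub e(1) w wF e(2)])
  finally show ?thesis by simp
qed

section \<open>Summation of the recursions\<close>

text \<open>
  The partial sums alone do not give an inductive claim. The terms \<open>(1 - \<rho>) \<Delta> N\<close> and
  \<open>C' * U N\<close> record what the next step still inherits from index \<open>N\<close>; summing the recursion
  then makes them telescope.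
\<close>

lemma sum_le_if_contracting:
  fixes \<Delta> U :: "nat \<Rightarrow> real"
  assumes "0 < \<rho>" "\<rho> \<le> 1" "0 \<le> C" "0 \<le> C'" and \<Delta>0: "\<And>k. 0 \<le> \<Delta> k" and U0: "U 0 = 0" "\<And>k. 0 \<le> U k"
    and rec: "\<And>k. \<Delta> k \<le> (1 - \<rho>) * (if k = 0 then 0 else \<Delta> (k - 1)) + C * U k + C' * U (k - 1)"
  shows "(\<Sum>k\<le>N. \<Delta> k) \<le> (C + C') / \<rho> * (\<Sum>k\<le>N. U k)"
proof -
  have "\<rho> * (\<Sum>k\<le>N. \<Delta> k) + (1 - \<rho>) * \<Delta> N + C' * U N \<le> (C + C') * (\<Sum>k\<le>N. U k)"
  proof (induction N)
    case 0
    then show ?case using rec[of 0] U0 by (simp add: algebra_simps)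
  next
    case (Suc N)
    then show ?case using rec[of "Suc N"] by (simp add: algebra_simps)
  qed
  moreover have "0 \<le> (1 - \<rho>) * \<Delta> N" "0 \<le> C' * U N"
    using assms by auto
  ultimately show ?thesis
    using assms(1) by (simp add: field_simps)
qed

text \<open>
  The right-hand side counts increments up to \<open>D N\<close> and the left-hand side up to \<open>D (Suc N)\<close>,
  so that increments can be absorbed from right to left.
\<close>

lemma telescoped_lyapunov_bound:
  fixes A D g d \<epsilon> U :: "nat \<Rightarrow> real"
  assumes step: "\<And>k. A (Suc k) + c * D (Suc k) + q * g k \<le> A k + \<alpha> * d k + \<beta> * \<epsilon> k"
    and "0 \<le> \<alpha>" "0 \<le> \<beta>" "0 \<le> r"
    and A: "\<And>k. 0 \<le> A k" and dU: "\<And>k. d k \<le> U k" and UD: "\<And>k. U k \<le> l * D k"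
    and \<epsilon>: "\<And>N. (\<Sum>k\<le>N. \<epsilon> k) \<le> r * (\<Sum>k\<le>N. U k)"
  shows "c * (\<Sum>k\<le>N. D (Suc k)) + q * (\<Sum>k\<le>N. g k) \<le> A 0 + (\<alpha> + \<beta> * r) * l * (\<Sum>k\<le>N. D k)"
proof -
  have "A (Suc N) + c * (\<Sum>k\<le>N. D (Suc k)) + q * (\<Sum>k\<le>N. g k)
      \<le> A 0 + \<alpha> * (\<Sum>k\<le>N. d k) + \<beta> * (\<Sum>k\<le>N. \<epsilon> k)"
  proof (induction N)
    case 0
    show ?case using step[of 0] by simp
  next
    case (Suc N)
    then show ?case using step[of "Suc N"] by (simp add: algebra_simps)
  qed
  also have "\<dots> \<le> A 0 + \<alpha> * (\<Sum>k\<le>N. U k) + \<beta> * (r * (\<Sum>k\<le>N. U k))"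
    using assms by (intro add_mono mult_left_mono sum_mono order_refl) auto
  also have "\<dots> = A 0 + (\<alpha> + \<beta> * r) * (\<Sum>k\<le>N. U k)"
    by (simp add: algebra_simps)
  also have "\<dots> \<le> A 0 + (\<alpha> + \<beta> * r) * (\<Sum>k\<le>N. l * D k)"
    using assms by (intro add_mono mult_left_mono sum_mono order_refl) auto
  finally show ?thesis
    using A[of "Suc N"] by (simp add: sum_distrib_left[symmetric] mult.assoc)
qed

section \<open>Convergence rate of the variance-reduced scheme\<close>

theorem theorem3p1:
  fixes P :: "'a measure"
    and n :: nat
    and G :: "nat \<Rightarrow> real^'p \<Rightarrow> real^'p"
    and x S :: "nat \<Rightarrow> 'a \<Rightarrow> real^'p"
    and x0 xs :: "real^'p"
    and \<gamma> \<rho> C C' M \<delta> L \<kappa> \<eta> \<Theta>1 \<Theta>2 :: real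
    and K :: nat
  assumes "prob_space P"
    and "1 \<le> n"
    and "1/2 < \<gamma>" "\<gamma> < 1"
    and "0 < \<rho>" "\<rho> \<le> 1" "0 \<le> C" "0 \<le> C'"
    and "M = \<gamma> * (1 + 5*\<gamma>) / (3 * (2*\<gamma> - 1))
           + (1 + 6*\<gamma>) / (3 * (2*\<gamma> - 1)) * ((C + C') / \<rho>)"
    and "\<delta> = (2*\<gamma> - 1) / (8 * sqrt M)"
    and "{y. avg_op n G y = 0} \<noteq> {}"
    and "0 < L"
    and "\<And>y z. (1 / real n) * (\<Sum>i=1..n. (norm (G i y - G i z))\<^sup>2) \<le> L\<^sup>2 * (norm (y - z))\<^sup>2"
    and "avg_op n G xs = 0"
    and "0 \<le> \<kappa>"
    and "\<And>y. avg_op n G y \<bullet> (y - xs) \<ge> - \<kappa> * (norm (avg_op n G y))\<^sup>2"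
    and "L * \<kappa> \<le> \<delta>"
    and "\<And>\<omega>. \<omega> \<in> space P \<Longrightarrow> x 0 \<omega> = x0"
    and "\<And>k \<omega>. \<omega> \<in> space P \<Longrightarrow> x (Suc k) \<omega> = x k \<omega> - \<eta> *\<^sub>R S k \<omega>"
    and "\<And>\<omega>. \<omega> \<in> space P \<Longrightarrow> S 0 \<omega> = (1 - \<gamma>) *\<^sub>R avg_op n G x0"
    and "vr_estimator P n G \<gamma> x S \<rho> C C'"
    and "0 < \<eta>"
    and "8 * \<kappa> / (2*\<gamma> - 1) \<le> \<eta>" "\<eta> \<le> 1 / (L * sqrt M)"
    and "\<Theta>1 = 2 * (1 + L\<^sup>2 * \<eta>\<^sup>2) / (\<gamma> * (1 - \<gamma>) * \<eta>\<^sup>2)"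
    and "\<Theta>2 = 8 * (1 + L\<^sup>2 * \<eta>\<^sup>2) / (3 * (2*\<gamma> - 1) * (1 - M * L\<^sup>2 * \<eta>\<^sup>2))"
  shows "ennreal (1 / real (K + 1)) * (\<Sum>k=0..K. mean_sq P (\<lambda>\<omega>. avg_op n G (x k \<omega>)))
           \<le> ennreal (\<Theta>1 * (norm (x0 - xs))\<^sup>2 / real (K + 1))
       \<and> (\<eta> \<noteq> 1 / (L * sqrt M) \<longrightarrow>
           ennreal (1 / real (K + 1)) * (\<Sum>k=1..K. mean_sq P (\<lambda>\<omega>. x k \<omega> - x (k - 1) \<omega>))
           \<le> ennreal (\<Theta>2 * (norm (x0 - xs))\<^sup>2 / real (K + 1)))"
proof -
  note prob = assms(1) and n = assms(2) and \<gamma> = assms(3,4) and \<rho> = assms(5,6) and C = assms(7,8)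
    and M_def = assms(9) and L = assms(12) and lip_avg = assms(13) and zero = assms(14)
    and weak = assms(16) and x0 = assms(18) and xSuc = assms(19) and vr = assms(21)
    and \<eta> = assms(22) and \<eta>_lower = assms(23) and \<eta>_upper = assms(24)
    and \<Theta>1_def = assms(25) and \<Theta>2_def = assms(26)
  interpret prob_space P by (rule prob)
  define H where "H = avg_op n G"
  define e where "e k \<omega> = S k \<omega> - fr_direction \<gamma> H x k \<omega>" for k \<omega>
  define c where "c = 3 * (2*\<gamma> - 1) / 4"
  define r where "r = (C + C') / \<rho>"

  obtain \<Delta> :: "nat \<Rightarrow> real" where \<Delta>: "\<And>k. 0 \<le> \<Delta> k"
    and ce: "\<And>k. AE \<omega> in P. vec_cond_exp P (history P x k) (e k) \<omega> = 0"
    and var: "\<And>k. mean_sq P (e k) \<le> ennreal (\<Delta> k)"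
    and rec: "\<And>k. ennreal (\<Delta> k) \<le> ennreal ((1 - \<rho>) * (if k = 0 then 0 else \<Delta> (k - 1)))
              + ennreal C * mean_sq_incr P n G x k + ennreal C' * mean_sq_incr P n G x (k - 1)"
    and meas: "\<And>k. x k \<in> borel_measurable P" "\<And>k. S k \<in> borel_measurable P"
    using vr unfolding vr_estimator_def e_def[abs_def] H_def by auto

  have lipH: "(norm (H y - H z))\<^sup>2 \<le> L\<^sup>2 * (norm (y - z))\<^sup>2" for y z
    unfolding H_def using avg_op_diff_sq_le[OF n] lip_avg by (rule order_trans)
  \<comment> \<open>A single \<open>G i\<close> inherits only the crude constant \<open>sqrt n * L\<close>, which does not enter the
    rates: it is needed for measurability and finite second moments.\<close>
  have lipG: "(norm (G i y - G i z))\<^sup>2 \<le> (sqrt (real n) * L)\<^sup>2 * (norm (y - z))\<^sup>2" if "i \<in> {1..n}" for i y z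
  proof -
    have "(norm (G i y - G i z))\<^sup>2 \<le> (\<Sum>i=1..n. (norm (G i y - G i z))\<^sup>2)"
      using that by (intro member_le_sum) auto
    also have "\<dots> \<le> real n * (L\<^sup>2 * (norm (y - z))\<^sup>2)"
      using lip_avg[of y z] n by (simp add: divide_simps mult_ac)
    finally show ?thesis by (simp add: power_mult_distrib)
  qed

  have [measurable]: "H \<in> borel_measurable borel"
    using lipH by (rule borel_measurable_if_sq_lipschitz)
  note [measurable] = meas
  have e_sq: "sq_integrable P (e k)" for k
    using var[of k] unfolding e_def[abs_def] fr_direction_def
    by (intro sq_integrable_if_mean_sq_bounded) measurable
  have x_sq: "sq_integrable P (x k)" for k
  proof (induction k rule: less_induct)
    case (less k)
    show ?case
    proof (cases k)
      case 0
      then show ?thesis using sq_integrable_const x0 by (simp cong: sq_integrable_cong)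
    next
      case (Suc m)
      have "x k \<omega> = x m \<omega> - \<eta> *\<^sub>R (e m \<omega> + (H (x m \<omega>) - \<gamma> *\<^sub>R H (x (m-1) \<omega>)))"
        if "\<omega> \<in> space P" for \<omega>
        using xSuc[OF that] by (simp add: Suc e_def fr_direction_def)
      then show ?thesis
        using Suc by (subst sq_integrable_cong)
          (auto intro!: sq_integrable_diff sq_integrable_add sq_integrable_scaleR
            sq_integrable_lipschitz[OF _ lipH] e_sq less)
    qed
  qed
  have Hx_sq: "sq_integrable P (\<lambda>\<omega>. H (x k \<omega>))" for k
    by (rule sq_integrable_lipschitz[OF x_sq lipH])
  have dx_sq: "sq_integrable P (\<lambda>\<omega>. x k \<omega> - x j \<omega>)" for k j
    by (intro sq_integrable_diff x_sq)
  have dG_sq: "sq_integrable P (\<lambda>\<omega>. G i (x k \<omega>) - G i (x j \<omega>))" if "i \<in> {1..n}" for i k j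
    by (intro sq_integrable_diff sq_integrable_lipschitz[OF x_sq lipG[OF that]])
  have int: "integrable P (\<lambda>\<omega>. (norm (f \<omega>))\<^sup>2)" if "sq_integrable P f" for f :: "'a \<Rightarrow> real^'p"
    using that by (simp add: sq_integrable_def)

  \<comment> \<open>The real second moments: \<open>A\<close> is the shifted distance, \<open>U\<close> the averaged increment of the
    operators. At \<open>k = 0\<close>, truncated subtraction makes \<open>D\<close>, \<open>d\<close> and \<open>U\<close> vanish.\<close>
  define A where "A k = (\<integral>\<omega>. (norm (x k \<omega> + (\<gamma>*\<eta>) *\<^sub>R H (x (k-1) \<omega>) - xs))\<^sup>2 \<partial>P)" for k
  define D where "D k = (\<integral>\<omega>. (norm (x k \<omega> - x (k-1) \<omega>))\<^sup>2 \<partial>P)" for k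
  define g where "g k = (\<integral>\<omega>. (norm (H (x k \<omega>)))\<^sup>2 \<partial>P)" for k
  define d where "d k = (\<integral>\<omega>. (norm (H (x k \<omega>) - H (x (k-1) \<omega>)))\<^sup>2 \<partial>P)" for k
  define \<epsilon> where "\<epsilon> k = (\<integral>\<omega>. (norm (e k \<omega>))\<^sup>2 \<partial>P)" for k
  define U where "U k = 1 / real n * (\<Sum>i=1..n. \<integral>\<omega>. (norm (G i (x k \<omega>) - G i (x (k-1) \<omega>)))\<^sup>2 \<partial>P)" for k

  have nonneg: "0 \<le> A k" "0 \<le> D k" "0 \<le> g k" "0 \<le> U k" for k
    by (auto simp: A_def D_def g_def U_def intro!: sum_nonneg divide_nonneg_nonneg)
  have c: "0 < c" using \<gamma> by (simp add: c_def)
  have r: "0 \<le> r" using \<rho> C by (simp add: r_def)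
  have \<alpha>: "0 \<le> \<gamma>*(1-\<gamma>+c)*\<eta>\<^sup>2" and \<beta>: "0 \<le> (1+c)*\<eta>\<^sup>2"
    using \<gamma> c by auto

  have incr: "mean_sq_incr P n G x k = ennreal (U k)" for k
  proof -
    have "mean_sq_incr P n G x k = ennreal (1 / real n) *
        (\<Sum>i=1..n. ennreal (\<integral>\<omega>. (norm (G i (x k \<omega>) - G i (x (k-1) \<omega>)))\<^sup>2 \<partial>P))"
      unfolding mean_sq_incr_def
      by (intro arg_cong2[of _ _ _ _ "(*)"] refl sum.cong mean_sq_eq_integral dG_sq)
    then show ?thesis
      unfolding U_def by (subst ennreal_mult) (auto intro!: sum_nonneg)
  qed
  have \<Delta>_rec: "\<Delta> k \<le> (1 - \<rho>) * (if k = 0 then 0 else \<Delta> (k - 1)) + C * U k + C' * U (k - 1)" for k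
  proof -
    have nn: "0 \<le> (1 - \<rho>) * (if k = 0 then 0 else \<Delta> (k - 1))"
      using \<rho> \<Delta> by auto
    have "ennreal (\<Delta> k) \<le> ennreal ((1 - \<rho>) * (if k = 0 then 0 else \<Delta> (k - 1)) + C * U k + C' * U (k - 1))"
      using rec[of k] nn C nonneg by (simp add: incr ennreal_plus ennreal_mult del: ennreal_plus[symmetric])
    then show ?thesis
      using nn C nonneg by (subst (asm) ennreal_le_iff) auto
  qed
  have \<epsilon>_le: "\<epsilon> k \<le> \<Delta> k" for k
    using var[of k] \<Delta> by (simp add: mean_sq_eq_integral[OF e_sq] \<epsilon>_def)
  have \<epsilon>_sum: "(\<Sum>k\<le>m. \<epsilon> k) \<le> r * (\<Sum>k\<le>m. U k)" for m
  proof -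
    have "U 0 = 0" by (simp add: U_def)
    then have "(\<Sum>k\<le>m. \<Delta> k) \<le> r * (\<Sum>k\<le>m. U k)"
      unfolding r_def using \<Delta> nonneg(4) \<Delta>_rec by (intro sum_le_if_contracting \<rho> C) auto
    with sum_mono[of "{..m}" \<epsilon> \<Delta>, OF \<epsilon>_le] show ?thesis by linarith
  qed
  have U_alt: "U k = (\<integral>\<omega>. 1 / real n * (\<Sum>i=1..n. (norm (G i (x k \<omega>) - G i (x (k-1) \<omega>)))\<^sup>2) \<partial>P)" for k
    unfolding U_def using dG_sq by (subst Bochner_Integration.integral_mult_right_zero, subst Bochner_Integration.integral_sum) (auto intro: int)
  have U_int: "integrable P (\<lambda>\<omega>. 1 / real n * (\<Sum>i=1..n. (norm (G i (x k \<omega>) - G i (x (k-1) \<omega>)))\<^sup>2))" for k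
    by (intro integrable_mult_right Bochner_Integration.integrable_sum int dG_sq)
  have d_le: "d k \<le> U k" for k
    unfolding d_def U_alt
    by (intro integral_mono U_int int sq_integrable_diff Hx_sq) (simp only: H_def avg_op_diff_sq_le[OF n])
  have U_le: "U k \<le> L\<^sup>2 * D k" for k
  proof -
    have "U k \<le> (\<integral>\<omega>. L\<^sup>2 * (norm (x k \<omega> - x (k-1) \<omega>))\<^sup>2 \<partial>P)"
      unfolding U_alt by (intro integral_mono U_int integrable_mult_right int dx_sq lip_avg)
    then show ?thesis by (simp add: D_def)
  qed

  have \<eta>_lower': "8 * \<kappa> \<le> (2*\<gamma> - 1) * \<eta>"
    using \<eta>_lower \<gamma> by (simp add: field_simps)
  have step: "A (Suc k) + c * D (Suc k) + \<gamma>*(1-\<gamma>)*\<eta>\<^sup>2*(1+c) * g (k-1)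
      \<le> A k + \<gamma>*(1-\<gamma>+c)*\<eta>\<^sup>2 * d k + (1+c)*\<eta>\<^sup>2 * \<epsilon> k" for k
    unfolding A_def D_def g_def d_def \<epsilon>_def diff_Suc_1
    by (rule reflected_step_expectation_bound[where F = "history P x k" and L = L, OF
          subalgebra_history[OF meas(1)] x_sq measurable_history x_sq measurable_history
          e_sq ce lipH _ \<gamma> \<eta> \<eta>_lower' _ c_def])
      (use xSuc weak in \<open>auto simp: e_def fr_direction_def H_def\<close>)

  have A0: "A 0 \<le> 2 * (1 + L\<^sup>2 * \<eta>\<^sup>2) * (norm (x0 - xs))\<^sup>2"
  proof -
    have "A 0 = (\<integral>\<omega>. (norm ((x0 - xs) + (\<gamma>*\<eta>) *\<^sub>R H x0))\<^sup>2 \<partial>P)"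
      unfolding A_def using x0 by (intro Bochner_Integration.integral_cong) (auto simp: algebra_simps)
    also have "\<dots> = (norm ((x0 - xs) + (\<gamma>*\<eta>) *\<^sub>R H x0))\<^sup>2"
      using prob_space by simp
    also have "\<dots> \<le> 2 * (norm (x0 - xs))\<^sup>2 + 2 * (norm ((\<gamma>*\<eta>) *\<^sub>R H x0))\<^sup>2"
      by (rule norm_add_sq_le)
    also have "(norm ((\<gamma>*\<eta>) *\<^sub>R H x0))\<^sup>2 = (\<gamma>\<^sup>2 * \<eta>\<^sup>2) * (norm (H x0 - H xs))\<^sup>2"
      using zero by (simp add: H_def power_mult_distrib)
    also have "\<dots> \<le> (1 * \<eta>\<^sup>2) * (L\<^sup>2 * (norm (x0 - xs))\<^sup>2)"
      using \<gamma> by (intro mult_mono lipH) (auto simp: power_le_one)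
    finally show ?thesis by (simp add: algebra_simps)
  qed

  have M: "0 < M"
    unfolding M_def using \<gamma> \<rho> C by (intro add_pos_nonneg divide_pos_pos mult_nonneg_nonneg divide_nonneg_nonneg) auto
  \<comment> \<open>In \<open>c * M\<close> the factor \<open>2*\<gamma> - 1\<close> cancels. There \<open>r\<close> has weight \<open>(1+6*\<gamma>)/4\<close>,
    which is \<open>1 + c\<close>, and the other summand dominates \<open>\<gamma>*(1-\<gamma>+c)\<close>, which is
    \<open>\<gamma>*(1+2*\<gamma>)/4\<close>.\<close>
  have coeff: "(\<gamma>*(1-\<gamma>+c)*\<eta>\<^sup>2 + (1+c)*\<eta>\<^sup>2 * r) * L\<^sup>2 \<le> c * (M * L\<^sup>2 * \<eta>\<^sup>2)"
  proof -
    have "c * M = (\<gamma> * (1 + 5*\<gamma>) + (1 + 6*\<gamma>) * r) / 4"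
    proof -
      have "3 * t / 4 * (a / (3 * t) + b / (3 * t) * r) = (a + b * r) / 4" if "t \<noteq> 0" for a b t
        using that by (simp add: field_simps)
      note cancel = this
      show ?thesis
        unfolding M_def c_def r_def[symmetric] by (rule cancel) (use \<gamma> in simp)
    qed
    moreover have "\<gamma>*(1-\<gamma>+c) + (1+c) * r \<le> (\<gamma> * (1 + 5*\<gamma>) + (1 + 6*\<gamma>) * r) / 4"
      using \<gamma> mult_nonneg_nonneg[of \<gamma> \<gamma>] by (simp add: c_def field_simps)
    ultimately have "\<gamma>*(1-\<gamma>+c) + (1+c) * r \<le> c * M" by simp
    then have "(\<gamma>*(1-\<gamma>+c) + (1+c) * r) * (L\<^sup>2 * \<eta>\<^sup>2) \<le> (c * M) * (L\<^sup>2 * \<eta>\<^sup>2)"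
      by (intro mult_right_mono) auto
    then show ?thesis by (simp add: algebra_simps)
  qed
  \<comment> \<open>The step size bound in product form; the excluded step size is the case of equality.\<close>
  have s: "0 \<le> L * \<eta> * sqrt M" "L * \<eta> * sqrt M \<le> 1"
    using L \<eta> M \<eta>_upper by (auto simp: field_simps)
  have s_sq: "M * L\<^sup>2 * \<eta>\<^sup>2 = (L * \<eta> * sqrt M)\<^sup>2"
    using M by (simp add: power_mult_distrib)
  have gap: "0 \<le> 1 - M * L\<^sup>2 * \<eta>\<^sup>2"
    unfolding s_sq using s by (simp add: power_le_one)

  have main: "c * (1 - M * L\<^sup>2 * \<eta>\<^sup>2) * (\<Sum>k\<le>m. D (Suc k))
      + \<gamma>*(1-\<gamma>)*\<eta>\<^sup>2*(1+c) * (\<Sum>k\<le>m. g (k-1)) \<le> A 0" for m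
  proof -
    have "D 0 = 0" by (simp add: D_def)
    then have "(\<Sum>k\<le>Suc m. D k) = (\<Sum>k\<le>m. D (Suc k))"
      by (simp add: sum.atMost_Suc_shift del: sum.atMost_Suc)
    with nonneg(2) have shift: "(\<Sum>k\<le>m. D k) \<le> (\<Sum>k\<le>m. D (Suc k))"
      by (metis sum.atMost_Suc le_add_same_cancel1)
    have "c * (\<Sum>k\<le>m. D (Suc k)) + \<gamma>*(1-\<gamma>)*\<eta>\<^sup>2*(1+c) * (\<Sum>k\<le>m. g (k-1))
        \<le> A 0 + (\<gamma>*(1-\<gamma>+c)*\<eta>\<^sup>2 + (1+c)*\<eta>\<^sup>2 * r) * L\<^sup>2 * (\<Sum>k\<le>m. D k)"
      by (rule telescoped_lyapunov_bound[OF step \<alpha> \<beta> r nonneg(1) d_le U_le \<epsilon>_sum])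
    also have "\<dots> \<le> A 0 + c * (M * L\<^sup>2 * \<eta>\<^sup>2) * (\<Sum>k\<le>m. D (Suc k))"
      using c M nonneg(2)
      by (intro add_left_mono mult_mono[OF coeff shift]) (auto intro!: sum_nonneg mult_nonneg_nonneg)
    finally show ?thesis by (simp add: algebra_simps)
  qed
  have q: "0 < \<gamma>*(1-\<gamma>)*\<eta>\<^sup>2" using \<gamma> \<eta> by simp

  have first: "(\<Sum>k=0..K. g k) \<le> \<Theta>1 * (norm (x0 - xs))\<^sup>2"
  proof -
    \<comment> \<open>The bound controls \<open>g (k-1)\<close>, so the sum has to run to \<open>K + 1\<close> to reach \<open>g K\<close>.\<close>
    have shift: "(\<Sum>k=0..K. g k) \<le> (\<Sum>k\<le>Suc K. g (k-1))"
      using nonneg(3) by (simp add: sum.atMost_Suc_shift atLeast0AtMost del: sum.atMost_Suc)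
    have "\<gamma>*(1-\<gamma>)*\<eta>\<^sup>2 \<le> \<gamma>*(1-\<gamma>)*\<eta>\<^sup>2*(1+c)"
      using mult_nonneg_nonneg[of _ c, OF less_imp_le[OF q]] c by (simp add: distrib_left)
    then have "\<gamma>*(1-\<gamma>)*\<eta>\<^sup>2 * (\<Sum>k=0..K. g k) \<le> \<gamma>*(1-\<gamma>)*\<eta>\<^sup>2*(1+c) * (\<Sum>k\<le>Suc K. g (k-1))"
      by (rule mult_mono[OF _ shift]) (use q c nonneg(3) in \<open>auto intro!: sum_nonneg\<close>)
    also have "\<dots> \<le> A 0"
    proof -
      have "0 \<le> c * (1 - M * L\<^sup>2 * \<eta>\<^sup>2) * (\<Sum>k\<le>Suc K. D (Suc k))"
        using c gap nonneg(2) by (intro mult_nonneg_nonneg sum_nonneg) auto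
      with main[of "Suc K"] show ?thesis by linarith
    qed
    also note A0
    finally have "(\<Sum>k=0..K. g k) \<le> 2 * (1 + L\<^sup>2 * \<eta>\<^sup>2) * (norm (x0 - xs))\<^sup>2 / (\<gamma>*(1-\<gamma>)*\<eta>\<^sup>2)"
      using q by (subst pos_le_divide_eq) (simp_all add: mult.commute)
    then show ?thesis by (simp add: \<Theta>1_def)
  qed
  have second: "(\<Sum>k=1..K. D k) \<le> \<Theta>2 * (norm (x0 - xs))\<^sup>2" if "\<eta> \<noteq> 1 / (L * sqrt M)"
  proof -
    have "L * \<eta> * sqrt M \<noteq> 1"
      using that L M by (auto simp: field_simps)
    with s have "(L * \<eta> * sqrt M)\<^sup>2 < 1"
      by (simp add: power_less_one_iff)
    then have "0 < 1 - M * L\<^sup>2 * \<eta>\<^sup>2" by (simp add: s_sq)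
    then have pos: "0 < c * (1 - M * L\<^sup>2 * \<eta>\<^sup>2)" using c by simp
    have "(\<Sum>k=1..K. D k) \<le> (\<Sum>k\<le>K. D (Suc k))"
      using nonneg(2) by (simp add: sum.shift_bounds_cl_Suc_ivl[of D 0, symmetric] atLeast0AtMost[symmetric] del: sum.shift_bounds_cl_Suc_ivl) 
    then have "c * (1 - M * L\<^sup>2 * \<eta>\<^sup>2) * (\<Sum>k=1..K. D k)
        \<le> c * (1 - M * L\<^sup>2 * \<eta>\<^sup>2) * (\<Sum>k\<le>K. D (Suc k))"
      using pos by (intro mult_left_mono) auto
    also have "\<dots> \<le> A 0"
    proof -
      have "0 \<le> \<gamma>*(1-\<gamma>)*\<eta>\<^sup>2*(1+c) * (\<Sum>k\<le>K. g (k-1))"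
        using c \<gamma> nonneg(3) by (intro mult_nonneg_nonneg sum_nonneg) auto
      with main[of K] show ?thesis by linarith
    qed
    also note A0
    finally have "(\<Sum>k=1..K. D k)
        \<le> 2 * (1 + L\<^sup>2 * \<eta>\<^sup>2) * (norm (x0 - xs))\<^sup>2 / (c * (1 - M * L\<^sup>2 * \<eta>\<^sup>2))"
      using pos by (subst pos_le_divide_eq) (simp_all add: mult.commute)
    also have "\<dots> = \<Theta>2 * (norm (x0 - xs))\<^sup>2"
      by (simp add: \<Theta>2_def c_def)
    finally show ?thesis .
  qed
  have average: "ennreal (1 / real (K + 1)) * (\<Sum>k\<in>I. ennreal (f k)) \<le> ennreal (B / real (K + 1))"
    if "sum f I \<le> B" "\<And>k. 0 \<le> f k" for I B and f :: "nat \<Rightarrow> real"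
  proof -
    have "ennreal (1 / real (K + 1)) * (\<Sum>k\<in>I. ennreal (f k)) = ennreal (1 / real (K + 1) * sum f I)"
      using that(2) by (subst ennreal_mult) (auto intro!: sum_nonneg)
    then show ?thesis
      using that(1) by (simp add: ennreal_leI divide_right_mono)
  qed
  have "mean_sq P (\<lambda>\<omega>. avg_op n G (x k \<omega>)) = ennreal (g k)"
    "mean_sq P (\<lambda>\<omega>. x k \<omega> - x (k - 1) \<omega>) = ennreal (D k)" for k
    using mean_sq_eq_integral[OF Hx_sq] mean_sq_eq_integral[OF dx_sq]
    by (simp_all add: g_def D_def H_def)
  then show ?thesis
    using average[OF first] average[OF second] nonneg by simp
qed

end
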